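(* Let $q$ be a prime, let $u$ be a nonnegative integer with $u<q$, and let $n,k,d$ be positive integers with $k\le n$ and $d\le n$ such that $$\sum_{i=0}^{d-2}\binom{n-1}{i}(q-1)^i<q^{\,n-k},$$ so that an $[n',k',d]_q$ code containing the all-one vector as a codeword exists for some integers $n',k'$ with $n-d+2\le n'\le n+1$ and $k-d+2\le k'\le k+1$. Then there is a $\left(u,\left\lfloor\tfrac{d-1}{2}\right\rfloor\right)$-PSMC of length $n'$ over $\mathbb{F}_q$ (for partially stuck level $s=1$).
   Context: An $[n',k',d]_q$ code is a linear subspace of $\mathbb{F}_q^{n'}$ of dimension $k'$ with minimum Hamming distance at least $d$. Partially stuck cells. Fix a total ordering of $\mathbb{F}_q$ in which $a\ge 1\ge 0$ for all $a\in\mathbb{F}_q\setminus\{0\}$. A cell is partially stuck at level $s$ if it can only store values that are at least $s$. Here all partially stuck cells are partially stuck at level $s=1$, i.e. they can store exactly the nonzero elements of $\mathbb{F}_q$. $(u,t)$-PSMC (partially-stuck-at-masking code) of length $N$ over $\mathbb{F}_q$, for level $s=1$: a pair consisting of an encoder and a decoder. The encoder takes as input a set $\phi=\{\phi_0,\dots,\phi_{u-1}\}\subseteq\{0,\dots,N-1\}$ of $u$ positions of partially stuck cells and a message from a message space $\mathcal{M}$, and outputs a vector $c\in\mathbb{F}_q^{N}$ with $c_{\phi_i}\ge 1$ (i.e. $c_{\phi_i}\neq 0$) for all $i$. The decoder is a map (it does not receive $\phi$) that, for every encoder output $c$ and every $e\in\mathbb{F}_q^N$ of Hamming weight at most $t$,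 returns from $c+e$ the message that was encoded. *)

theory Defs
  imports "Jordan_Normal_Form.VS_Connect" "HOL-Computational_Algebra.Primes"
    "HOL-Library.Cardinality"
begin

definition hamming_dist :: "'a vec \<Rightarrow> 'a vec \<Rightarrow> nat" where
  "hamming_dist x y = card {i. i < dim_vec x \<and> x $ i \<noteq> y $ i}"

definition hamming_weight :: "'a::zero vec \<Rightarrow> nat" where
  "hamming_weight x = card {i. i < dim_vec x \<and> x $ i \<noteq> 0}"

definition all_one_vec :: "nat \<Rightarrow> 'a::one vec" where
  "all_one_vec N = vec N (\<lambda>_. 1)"

text \<open>The parameter \<open>d\<close> is a lower bound on the minimum distance, so it is
  a vacuous requirement for the zero code.\<close>

definition linear_code :: "nat \<Rightarrow> nat \<Rightarrow> nat \<Rightarrow> 'a::field vec set \<Rightarrow> bool" where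
  "linear_code N K d C \<longleftrightarrow>
     VectorSpace.subspace class_ring C (module_vec TYPE('a) N) \<and>
     vectorspace.dim class_ring ((module_vec TYPE('a) N)\<lparr>carrier := C\<rparr>) = K \<and>
     (\<forall>x\<in>C. \<forall>y\<in>C. x \<noteq> y \<longrightarrow> d \<le> hamming_dist x y)"

text \<open>A total order on the alphabet is a relation \<open>r\<close>, with \<open>(a, b) \<in> r\<close>
  meaning that \<open>a\<close> is at most \<open>b\<close>.\<close>

definition cell_order :: "'a::{zero,one} rel \<Rightarrow> bool" where
  "cell_order r \<longleftrightarrow> linear_order r \<and> (0, 1) \<in> r \<and> (\<forall>a. a \<noteq> 0 \<longrightarrow> (1, a) \<in> r)"

text \<open>An encoder and a decoder, with message space \<open>M\<close>, that mask any \<open>u\<close> cells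
  partially stuck at level \<open>s\<close> and correct \<open>t\<close> errors. The decoder is not given the
  set \<open>P\<close> of stuck positions.\<close>

definition psmc ::
  "'a::ring rel \<Rightarrow> 'a \<Rightarrow> nat \<Rightarrow> nat \<Rightarrow> nat \<Rightarrow> 'm set \<Rightarrow>
    (nat set \<Rightarrow> 'm \<Rightarrow> 'a vec) \<Rightarrow> ('a vec \<Rightarrow> 'm) \<Rightarrow> bool" where
  "psmc r s u t N M enc dec \<longleftrightarrow>
     (\<forall>P m. P \<subseteq> {..<N} \<and> card P = u \<and> m \<in> M \<longrightarrow>
        enc P m \<in> carrier_vec N \<and>
        (\<forall>i\<in>P. (s, enc P m $ i) \<in> r) \<and>
        (\<forall>e\<in>carrier_vec N. hamming_weight e \<le> t \<longrightarrow> dec (enc P m + e) = m))"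

end

theory Submission
  imports Defs
begin

text \<open>
  Padding a code with parameters \<open>[N, K, d]\<close> by a zero coordinate and adjoining the generator
  \<open>(v, 1)\<close>, where \<open>v\<close> has distance at least \<open>d - 1\<close> from the code, gives a code with parameters \<open>[N + 1, K + 1, d]\<close>. Under the Gilbert-Varshamov
  inequality the balls of radius \<open>d - 2\<close> around the codewords do not cover the space, so such a \<open>v\<close>
  exists until length \<open>n\<close> is reached, starting with the zero code of length \<open>n - k\<close>.
  For the resulting code \<open>C\<close> there are two cases. If the all-one vector has distance at
  least \<open>d - 1\<close> from \<open>C\<close>, one more extension, with \<open>v\<close> the all-one vector, puts the all-one vector of
  length \<open>n + 1\<close> into the code. Otherwise some codeword has at most \<open>d - 2\<close> zeros; shortening \<open>C\<close> at
  these zeros and rescaling the remaining coordinates turns that codeword into the all-one vector.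
  A code that contains the all-one vector masks: adding a suitable multiple of it makes all stuck
  cells nonzero, and the message is read off modulo these multiples.
\<close>

section \<open>Subspaces and their cardinality\<close>

text \<open>Coordinates with respect to a basis put the vectors in bijection with the functions from
  the basis to the scalars. A finite carrier spans itself, so a finite basis exists.\<close>

lemma (in vectorspace) card_carrier:
  assumes fin: "finite (carrier V)"
  shows "card (carrier V) = card (carrier K) ^ dim"
proof -
  have "span (carrier V) = carrier V"
    by (metis in_own_span order_refl span_is_subset2 subset_antisym)
  then have fin_dim
    unfolding fin_dim_def using fin by (intro exI[of _ "carrier V"]) simp
  then obtain B where B: "finite B" "basis B"
    using finite_basis_exists by blast
  then have BV: "B \<subseteq> carrier V"
    by (simp add: basis_def)
  have uniq: "\<exists>!a. a \<in> B \<rightarrow>\<^sub>E carrier K \<and> lincomb a B = v" if "v \<in> carrier V" for v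
    using basis_criterion[OF B(1) BV] B(2) that by blast
  have "bij_betw (\<lambda>a. lincomb a B) (B \<rightarrow>\<^sub>E carrier K) (carrier V)"
  proof (rule bij_betwI')
    fix a assume "a \<in> B \<rightarrow>\<^sub>E carrier K"
    then show "lincomb a B \<in> carrier V"
      using BV by (intro lincomb_closed) (auto simp: PiE_def)
  next
    fix a b assume ab: "a \<in> B \<rightarrow>\<^sub>E carrier K" "b \<in> B \<rightarrow>\<^sub>E carrier K"
    then have "lincomb a B \<in> carrier V"
      using BV by (intro lincomb_closed) (auto simp: PiE_def)
    with uniq[of "lincomb a B"] ab show "lincomb a B = lincomb b B \<longleftrightarrow> a = b"
      by metis
  next
    fix v assume "v \<in> carrier V"
    then show "\<exists>a \<in> B \<rightarrow>\<^sub>E carrier K. v = lincomb a B"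
      using uniq by metis
  qed
  then have "card (carrier V) = card (B \<rightarrow>\<^sub>E carrier K)"
    by (simp add: bij_betw_same_card)
  also have "\<dots> = card (carrier K) ^ card B"
    using B(1) by (simp add: card_PiE)
  finally show ?thesis
    using dim_basis B by simp
qed

abbreviation vec_subspace :: "nat \<Rightarrow> 'a::field vec set \<Rightarrow> bool" where
  "vec_subspace N C \<equiv> VectorSpace.subspace class_ring C (module_vec TYPE('a) N)"

lemma vec_subspace_iff:
  fixes C :: "'a::field vec set"
  shows "vec_subspace N C \<longleftrightarrow> C \<subseteq> carrier_vec N \<and> 0\<^sub>v N \<in> C \<and>
    (\<forall>x\<in>C. \<forall>y\<in>C. x + y \<in> C) \<and> (\<forall>a. \<forall>x\<in>C. a \<cdot>\<^sub>v x \<in> C)"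
  unfolding VectorSpace.subspace_def submodule_def
  using vec_vs[where ?'a = 'a] vec_module[where ?'a = 'a]
  by (auto simp: module_vec_simps)

lemma vec_subspaceD:
  fixes C :: "'a::field vec set"
  assumes "vec_subspace N C"
  shows "C \<subseteq> carrier_vec N" "0\<^sub>v N \<in> C"
    and "x \<in> C \<Longrightarrow> y \<in> C \<Longrightarrow> x + y \<in> C" "x \<in> C \<Longrightarrow> a \<cdot>\<^sub>v x \<in> C"
    and "x \<in> C \<Longrightarrow> y \<in> C \<Longrightarrow> x - y \<in> C"
proof -
  show sub: "C \<subseteq> carrier_vec N" "0\<^sub>v N \<in> C"
    and add: "\<And>x y. x \<in> C \<Longrightarrow> y \<in> C \<Longrightarrow> x + y \<in> C"
    and smult: "\<And>a x. x \<in> C \<Longrightarrow> a \<cdot>\<^sub>v x \<in> C"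
    using assms unfolding vec_subspace_iff by blast+
  assume xy: "x \<in> C" "y \<in> C"
  then have "x - y = x + (- 1) \<cdot>\<^sub>v y"
    using sub(1) by (intro eq_vecI) auto
  then show "x - y \<in> C"
    using add smult xy by metis
qed

lemma one_less_CARD_field: "1 < CARD('a::{field,finite})"
proof -
  have "card {0, 1 :: 'a} \<le> CARD('a)"
    by (intro card_mono) auto
  then show ?thesis by simp
qed

lemma card_carrier_vec: "card (carrier_vec N :: 'a::{field,finite} vec set) = CARD('a) ^ N"
  and finite_carrier_vec: "finite (carrier_vec N :: 'a vec set)"
proof -
  have "bij_betw (\<lambda>x. \<lambda>i\<in>{..<N}. x $ i) (carrier_vec N :: 'a vec set) ({..<N} \<rightarrow>\<^sub>E UNIV)"
    by (rule bij_betw_byWitness[where f' = "vec N"])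
      (auto intro!: eq_vecI simp: PiE_def extensional_def fun_eq_iff)
  from bij_betw_same_card[OF this] bij_betw_finite[OF this]
  show "card (carrier_vec N :: 'a vec set) = CARD('a) ^ N" "finite (carrier_vec N :: 'a vec set)"
    by (simp_all add: card_PiE finite_PiE)
qed

lemma card_vec_subspace:
  fixes C :: "'a::{field,finite} vec set"
  assumes "vec_subspace N C"
  shows "card C = CARD('a) ^ vectorspace.dim class_ring ((module_vec TYPE('a) N)\<lparr>carrier := C\<rparr>)"
proof -
  have "vectorspace class_ring ((module_vec TYPE('a) N)\<lparr>carrier := C\<rparr>)"
    using vectorspace.subspace_is_vs[OF vec_vs assms] .
  moreover have "finite C"
    using finite_carrier_vec vec_subspaceD(1)[OF assms] by (rule rev_finite_subset)
  ultimately show ?thesis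
    using vectorspace.card_carrier by fastforce
qed

section \<open>Codes by cardinality and minimum weight\<close>

text \<open>Recording \<open>q ^ K\<close> codewords instead of dimension \<open>K\<close> lets the
  constructions below certify dimensions by counting. By linearity, the weight of nonzero codewords
  stands for the distance.\<close>

definition weight_code :: "nat \<Rightarrow> nat \<Rightarrow> nat \<Rightarrow> 'a::field vec set \<Rightarrow> bool" where
  "weight_code N K d C \<longleftrightarrow> vec_subspace N C \<and> card C = CARD('a) ^ K \<and>
     (\<forall>x\<in>C. x \<noteq> 0\<^sub>v N \<longrightarrow> d \<le> hamming_weight x)"

lemma hamming_dist_eq_weight:
  fixes x y :: "'a::field vec"
  assumes "x \<in> carrier_vec N" "y \<in> carrier_vec N"
  shows "hamming_dist x y = hamming_weight (x - y)"
  using assms unfolding hamming_dist_def hamming_weight_def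
  by (intro arg_cong[where f = card]) auto

text \<open>The dimension is the exponent of the cardinality, which is unique because
  \<open>q > 1\<close>. Distinct codewords differ by a nonzero codeword.\<close>

lemma weight_code_imp_linear_code:
  fixes C :: "'a::{field,finite} vec set"
  assumes "weight_code N K d C"
  shows "linear_code N K d C"
proof -
  have sub: "vec_subspace N C" and card: "card C = CARD('a) ^ K"
    and wt: "\<And>x. x \<in> C \<Longrightarrow> x \<noteq> 0\<^sub>v N \<Longrightarrow> d \<le> hamming_weight x"
    using assms unfolding weight_code_def by auto
  have "vectorspace.dim class_ring ((module_vec TYPE('a) N)\<lparr>carrier := C\<rparr>) = K"
    using card_vec_subspace[OF sub] card one_less_CARD_field[where 'a = 'a]
    by (metis power_inject_exp)
  moreover have "d \<le> hamming_dist x y" if "x \<in> C" "y \<in> C" "x \<noteq> y" for x y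
  proof -
    have "x \<in> carrier_vec N" "y \<in> carrier_vec N"
      using that vec_subspaceD(1)[OF sub] by auto
    moreover have "x - y \<noteq> 0\<^sub>v N"
    proof
      assume eq: "x - y = 0\<^sub>v N"
      have "x $ i = y $ i" if "i < N" for i
        using arg_cong[OF eq, of "\<lambda>z. z $ i"] that calculation by simp
      then show False
        using \<open>x \<noteq> y\<close> calculation by auto
    qed
    ultimately show ?thesis
      using wt vec_subspaceD(5)[OF sub] that by (simp add: hamming_dist_eq_weight)
  qed
  ultimately show ?thesis
    using sub unfolding linear_code_def by blast
qed

section \<open>Hamming balls\<close>

text \<open>A vector is determined by its support and its nonzero values there; the union bound over
  supports gives the volume estimate. The strict inequality makes this the ball of radius
  \<open>D - 1\<close>.\<close>

lemma card_ball_le: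
  "card {x \<in> carrier_vec m :: 'a::{field,finite} vec set. hamming_weight x < D}
     \<le> (\<Sum>i<D. (m choose i) * (CARD('a) - 1) ^ i)"
proof -
  \<comment> \<open>The values avoid 0, so for \<open>S\<close> inside \<open>{..<m}\<close> these
    are the vectors with support exactly \<open>S\<close>.\<close>
  define F where "F S = (\<lambda>f. vec m (\<lambda>i. if i \<in> S then f i else (0::'a))) ` (S \<rightarrow>\<^sub>E (UNIV - {0}))"
    for S
  define U where "U i = {S. S \<subseteq> {..<m} \<and> card S = i}" for i
  have card_F: "card (F S) \<le> (CARD('a) - 1) ^ card S" if "finite S" for S
  proof -
    have "card (F S) \<le> card (S \<rightarrow>\<^sub>E (UNIV - {0::'a}))"
      unfolding F_def using that by (intro card_image_le finite_PiE) auto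
    also have "\<dots> = (CARD('a) - 1) ^ card S"
      using that by (simp add: card_PiE card_Diff_singleton)
    finally show ?thesis .
  qed
  have fin_U: "finite (U i)" for i
    unfolding U_def by (rule finite_subset[of _ "Pow {..<m}"]) auto
  have fin_S: "finite S" if "S \<in> U i" for S i
    using that finite_subset unfolding U_def by blast
  have "{x \<in> carrier_vec m :: 'a vec set. hamming_weight x < D} \<subseteq> (\<Union>i<D. \<Union>S\<in>U i. F S)"
  proof
    fix x :: "'a vec" assume "x \<in> {x \<in> carrier_vec m. hamming_weight x < D}"
    then have x: "x \<in> carrier_vec m" "hamming_weight x < D" by auto
    define S where "S = {i. i < m \<and> x $ i \<noteq> 0}"
    have "x = vec m (\<lambda>i. if i \<in> S then restrict (($) x) S i else 0)"
      using x(1) by (intro eq_vecI) (auto simp: S_def)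
    then have "x \<in> F S"
      unfolding F_def by (rule image_eqI[of _ _ "restrict (($) x) S"]) (auto simp: S_def)
    moreover have "S \<in> U (hamming_weight x)"
      using x(1) by (auto simp: S_def U_def hamming_weight_def)
    ultimately show "x \<in> (\<Union>i<D. \<Union>S\<in>U i. F S)"
      using x(2) by blast
  qed
  then have "card {x \<in> carrier_vec m :: 'a vec set. hamming_weight x < D}
      \<le> card (\<Union>i<D. \<Union>S\<in>U i. F S)"
    using fin_U fin_S by (intro card_mono finite_UN_I) (auto simp: F_def intro!: finite_PiE)
  also have "\<dots> \<le> (\<Sum>i<D. card (\<Union>S\<in>U i. F S))"
    by (intro card_UN_le) auto
  also have "\<dots> \<le> (\<Sum>i<D. \<Sum>S\<in>U i. card (F S))"
    by (intro sum_mono card_UN_le fin_U)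
  also have "\<dots> \<le> (\<Sum>i<D. \<Sum>S\<in>U i. (CARD('a) - 1) ^ i)"
  proof (intro sum_mono)
    fix i S assume "S \<in> U i"
    then show "card (F S) \<le> (CARD('a) - 1) ^ i"
      using card_F[OF fin_S] by (force simp: U_def)
  qed
  also have "\<dots> = (\<Sum>i<D. (m choose i) * (CARD('a) - 1) ^ i)"
    unfolding U_def by (simp add: n_subsets)
  finally show ?thesis .
qed

section \<open>Lengthening\<close>

text \<open>A new word has the form \<open>(c + a * v, a)\<close>. For \<open>a = 0\<close> it is a
  padded old word; otherwise it is \<open>a\<close> times \<open>(v - c', 1)\<close> with
  \<open>c'\<close> in \<open>C\<close>, and the last entry supplies the unit missing from
  \<open>d - 1\<close>.\<close>

lemma weight_code_extend:
  fixes C :: "'a::{field,finite} vec set"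
  assumes code: "weight_code N K d C" and v: "v \<in> carrier_vec N"
    and far: "\<And>c. c \<in> C \<Longrightarrow> d - 1 \<le> hamming_weight (v - c)"
  shows "\<exists>C'. weight_code (Suc N) (Suc K) d C' \<and> vec (Suc N) (\<lambda>i. if i < N then v $ i else 1) \<in> C'"
proof -
  have sub: "vec_subspace N C" and card: "card C = CARD('a) ^ K"
    and wt: "\<And>x. x \<in> C \<Longrightarrow> x \<noteq> 0\<^sub>v N \<Longrightarrow> d \<le> hamming_weight x"
    using code unfolding weight_code_def by auto
  note CN = vec_subspaceD(1)[OF sub]
  define F where "F = (\<lambda>(c, a). vec (Suc N) (\<lambda>i. if i < N then c $ i + a * v $ i else a))"
  define C' where "C' = F ` (C \<times> UNIV)"
  have F_in: "F (c, a) \<in> C'" if "c \<in> C" for c a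
    using that unfolding C'_def by blast
  have "inj_on F (C \<times> UNIV)"
  proof (rule inj_onI, clarify)
    fix c a c' a' assume c: "c \<in> C" "c' \<in> C" and eq: "F (c, a) = F (c', a')"
    have eq_i: "F (c, a) $ i = F (c', a') $ i" for i
      using eq by simp
    from eq_i[of N] have a: "a = a'"
      by (simp add: F_def)
    have "c $ i = c' $ i" if "i < N" for i
      using eq_i[of i] that a by (simp add: F_def)
    then show "c = c' \<and> a = a'"
      using a c CN by (metis carrier_vecD eq_vecI in_mono)
  qed
  then have card': "card C' = CARD('a) ^ Suc K"
    unfolding C'_def by (simp add: card_image card_cartesian_product card)
  have sub': "vec_subspace (Suc N) C'"
    unfolding vec_subspace_iff
  proof (intro conjI ballI allI)
    show "C' \<subseteq> carrier_vec (Suc N)"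
      by (auto simp: C'_def F_def)
    have "0\<^sub>v (Suc N) = F (0\<^sub>v N, 0)"
      by (intro eq_vecI) (auto simp: F_def)
    then show "0\<^sub>v (Suc N) \<in> C'"
      using F_in vec_subspaceD(2)[OF sub] by simp
  next
    fix x y assume "x \<in> C'" "y \<in> C'"
    then obtain c a c' a' where c: "c \<in> C" "c' \<in> C" and xy: "x = F (c, a)" "y = F (c', a')"
      by (auto simp: C'_def)
    have "x + y = F (c + c', a + a')"
      unfolding xy using c CN by (intro eq_vecI) (auto simp: F_def algebra_simps)
    then show "x + y \<in> C'"
      using F_in vec_subspaceD(3)[OF sub] c by simp
  next
    fix b x assume "x \<in> C'"
    then obtain c a where c: "c \<in> C" and x: "x = F (c, a)"
      by (auto simp: C'_def)
    have "b \<cdot>\<^sub>v x = F (b \<cdot>\<^sub>v c, b * a)"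
      unfolding x using c CN by (intro eq_vecI) (auto simp: F_def algebra_simps)
    then show "b \<cdot>\<^sub>v x \<in> C'"
      using F_in vec_subspaceD(4)[OF sub] c by simp
  qed
  have "d \<le> hamming_weight x" if "x \<in> C'" "x \<noteq> 0\<^sub>v (Suc N)" for x
  proof -
    from that(1) obtain c a where c: "c \<in> C" and x: "x = F (c, a)"
      by (auto simp: C'_def)
    have cN: "c \<in> carrier_vec N"
      using c CN by blast
    show ?thesis
    proof (cases "a = 0")
      case True
      have "c \<noteq> 0\<^sub>v N"
      proof
        assume "c = 0\<^sub>v N"
        then have "x = 0\<^sub>v (Suc N)"
          unfolding x True by (intro eq_vecI) (auto simp: F_def)
        then show False using that(2) by simp
      qed
      moreover have "hamming_weight x = hamming_weight c"
        unfolding hamming_weight_def using cN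
        by (intro arg_cong[where f = card]) (auto simp: x F_def True split: if_splits)
      ultimately show ?thesis
        using wt c by simp
    next
      case False
      \<comment> \<open>Here \<open>c' = - inverse a * c\<close>; factoring out the nonzero scalar
        \<open>a\<close> leaves the support unchanged, and the last coordinate \<open>N\<close>
        joins it.\<close>
      let ?S = "{i. i < N \<and> (v - (- inverse a) \<cdot>\<^sub>v c) $ i \<noteq> 0}"
      have "{i. i < dim_vec x \<and> x $ i \<noteq> 0} = insert N ?S"
        using False cN v by (auto simp: x F_def field_simps less_Suc_eq split: if_splits)
      then have "hamming_weight x = Suc (hamming_weight (v - (- inverse a) \<cdot>\<^sub>v c))"
        unfolding hamming_weight_def using cN v by simp
      moreover have "d - 1 \<le> hamming_weight (v - (- inverse a) \<cdot>\<^sub>v c)"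
        using far vec_subspaceD(4)[OF sub] c by blast
      ultimately show ?thesis by simp
    qed
  qed
  with sub' card' have "weight_code (Suc N) (Suc K) d C'"
    unfolding weight_code_def by blast
  moreover have "vec (Suc N) (\<lambda>i. if i < N then v $ i else 1) = F (0\<^sub>v N, 1)"
    by (intro eq_vecI) (auto simp: F_def)
  ultimately show ?thesis
    using F_in vec_subspaceD(2)[OF sub] by metis
qed

text \<open>Covering argument: otherwise the balls of radius \<open>D - 1\<close> around the
  codewords fill the space, and their total volume is too small for that.\<close>

lemma exists_far_vector:
  fixes C :: "'a::{field,finite} vec set"
  assumes "C \<subseteq> carrier_vec N"
    and small: "card C * (\<Sum>i<D. (N choose i) * (CARD('a) - 1) ^ i) < CARD('a) ^ N"
  shows "\<exists>v\<in>carrier_vec N. \<forall>c\<in>C. D \<le> hamming_weight (v - c)"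
proof (rule ccontr)
  let ?B = "{x \<in> carrier_vec N :: 'a vec set. hamming_weight x < D}"
  assume neg: "\<not> ?thesis"
  have "carrier_vec N \<subseteq> (\<lambda>(c, e). c + e) ` (C \<times> ?B)"
  proof (intro subsetI)
    fix v :: "'a vec" assume v: "v \<in> carrier_vec N"
    with neg obtain c where c: "c \<in> C" "hamming_weight (v - c) < D"
      by (auto simp: not_le)
    moreover have "v = c + (v - c)"
      using c v assms(1) by (intro eq_vecI) auto
    moreover have "v - c \<in> carrier_vec N"
      using c v assms(1) by auto
    ultimately show "v \<in> (\<lambda>(c, e). c + e) ` (C \<times> ?B)"
      by (intro image_eqI[of _ _ "(c, v - c)"]) auto
  qed
  moreover have fin: "finite (C \<times> ?B)"
    using finite_carrier_vec assms(1) finite_subset by (intro finite_cartesian_product) auto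
  ultimately have "CARD('a) ^ N \<le> card (C \<times> ?B)"
    unfolding card_carrier_vec[symmetric] by (meson card_image_le card_mono finite_imageI order_trans)
  also have "\<dots> \<le> card C * (\<Sum>i<D. (N choose i) * (CARD('a) - 1) ^ i)"
    unfolding card_cartesian_product by (intro mult_left_mono card_ball_le) auto
  finally show False
    using small by simp
qed

lemma weight_code_zero:
  "weight_code N 0 d {0\<^sub>v N :: 'a::field vec}"
  unfolding weight_code_def vec_subspace_iff by auto

text \<open>The redundancy \<open>r = n - k\<close> stays fixed while generators are added one at a
  time, so a single bound against \<open>q ^ r\<close> drives every step.\<close>

lemma gilbert_varshamov:
  assumes "k \<le> n" and bound: "(\<Sum>i<d - 1. ((n - 1) choose i) * (CARD('a) - 1) ^ i) < CARD('a) ^ (n - k)"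
  shows "\<exists>C :: 'a::{field,finite} vec set. weight_code n k d C"
proof -
  define r where "r = n - k"
  have "j \<le> k \<Longrightarrow> \<exists>C :: 'a vec set. weight_code (r + j) j d C" for j
  proof (induction j)
    case 0
    show ?case using weight_code_zero by fastforce
  next
    case (Suc j)
    then obtain C :: "'a vec set" where C: "weight_code (r + j) j d C"
      by auto
    \<comment> \<open>From \<open>Suc j \<le> k\<close> follows \<open>r + j \<le> n - 1\<close>,
      and binomials grow with the upper index.\<close>
    have "(\<Sum>i<d - 1. ((r + j) choose i) * (CARD('a) - 1) ^ i)
        \<le> (\<Sum>i<d - 1. ((n - 1) choose i) * (CARD('a) - 1) ^ i)"
      using Suc.prems assms(1) by (intro sum_mono mult_right_mono binomial_right_mono) (auto simp: r_def)
    \<comment> \<open>Multiply the bound against \<open>q ^ r\<close> by the \<open>q ^ j\<close>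
      codewords.\<close>
    then have "card C * (\<Sum>i<d - 1. ((r + j) choose i) * (CARD('a) - 1) ^ i) < CARD('a) ^ (r + j)"
      using C bound by (simp add: weight_code_def r_def power_add mult.commute)
    moreover have "C \<subseteq> carrier_vec (r + j)"
      using C vec_subspaceD(1) unfolding weight_code_def by blast
    ultimately obtain v where v: "v \<in> carrier_vec (r + j)" "\<forall>c\<in>C. d - 1 \<le> hamming_weight (v - c)"
      using exists_far_vector[of C "r + j" "d - 1"] by blast
    then have "\<And>c. c \<in> C \<Longrightarrow> d - 1 \<le> hamming_weight (v - c)"
      by blast
    from weight_code_extend[OF C v(1) this] show ?case
      by auto
  qed
  from this[of k] show ?thesis
    unfolding r_def using assms(1) by simp
qed

section \<open>Shortening\<close>

text \<open>Restriction to \<open>Z\<close> has at most \<open>q ^ card Z\<close> values, and each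
  nonempty fibre is a coset of its kernel. In terms of dimension, shortening at \<open>Z\<close>
  costs at most \<open>card Z\<close>.\<close>

lemma card_vec_subspace_le_shortened:
  fixes C :: "'a::{field,finite} vec set"
  assumes sub: "vec_subspace N C" and Z: "Z \<subseteq> {..<N}"
  shows "card C \<le> CARD('a) ^ card Z * card {x \<in> C. \<forall>i\<in>Z. x $ i = 0}"
proof -
  let ?C0 = "{x \<in> C. \<forall>i\<in>Z. x $ i = 0}"
  let ?P = "Z \<rightarrow>\<^sub>E (UNIV :: 'a set)"
  define fib where "fib f = {x \<in> C. restrict (($) x) Z = f}" for f
  have finZ: "finite Z"
    using Z finite_subset by blast
  have CN: "C \<subseteq> carrier_vec N"
    using vec_subspaceD(1)[OF sub] .
  have fin: "finite C"
    using finite_carrier_vec CN by (rule rev_finite_subset)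
  have fib_le: "card (fib f) \<le> card ?C0" for f
  proof (cases "fib f = {}")
    case False
    then obtain y where y: "y \<in> fib f" by blast
    show ?thesis
    \<comment> \<open>Subtracting a fixed member \<open>y\<close> moves the fibre injectively into
      the kernel.\<close>
    proof (rule card_inj_on_le[of "\<lambda>x. x - y"])
      show "inj_on (\<lambda>x. x - y) (fib f)"
      proof (rule inj_onI)
        fix x x' assume x: "x \<in> fib f" "x' \<in> fib f" and eq: "x - y = x' - y"
        have carr: "x \<in> carrier_vec N" "x' \<in> carrier_vec N" "y \<in> carrier_vec N"
          using x y CN by (auto simp: fib_def)
        have "x $ i = x' $ i" if "i < N" for i
          using arg_cong[OF eq, of "\<lambda>z. z $ i"] that carr by simp
        then show "x = x'" using carr by auto
      qed
      show "(\<lambda>x. x - y) ` fib f \<subseteq> ?C0"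
      proof clarify
        fix x assume x: "x \<in> fib f"
        have carr: "x \<in> carrier_vec N" "y \<in> carrier_vec N"
          using x y CN by (auto simp: fib_def)
        have "(x - y) $ i = 0" if "i \<in> Z" for i
        proof -
          have "restrict (($) x) Z i = restrict (($) y) Z i"
            using x y by (simp add: fib_def)
          then show ?thesis using that carr Z by auto
        qed
        then show "x - y \<in> C \<and> (\<forall>i\<in>Z. (x - y) $ i = 0)"
          using vec_subspaceD(5)[OF sub] x y by (auto simp: fib_def)
      qed
      show "finite ?C0" using fin by simp
    qed
  qed simp
  have finP: "finite ?P"
    using finZ by (intro finite_PiE) auto
  have "C \<subseteq> (\<Union>f\<in>?P. fib f)"
    by (auto simp: fib_def)
  moreover have "finite (\<Union>f\<in>?P. fib f)"
    using finP fin by (auto simp: fib_def)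
  ultimately have "card C \<le> card (\<Union>f\<in>?P. fib f)"
    by (rule card_mono[rotated])
  also have "\<dots> \<le> (\<Sum>f\<in>?P. card (fib f))"
    by (rule card_UN_le[OF finP])
  also have "\<dots> \<le> (\<Sum>f\<in>?P. card ?C0)"
    by (intro sum_mono fib_le)
  also have "\<dots> = CARD('a) ^ card Z * card ?C0"
    using finZ by (simp add: card_PiE)
  finally show ?thesis .
qed

text \<open>Keep the codewords vanishing wherever \<open>c\<close> does, delete those coordinates,
  and divide the others by the entries of \<open>c\<close>. Only zeros are deleted and the divisors
  are nonzero, so weights survive, while \<open>c\<close> itself becomes the all-one vector.\<close>

lemma weight_code_shorten:
  fixes C :: "'a::{field,finite} vec set"
  assumes code: "weight_code N K d C" and c: "c \<in> C"
  defines "Z \<equiv> {i. i < N \<and> c $ i = 0}"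
  shows "\<exists>(C' :: 'a vec set) k'. weight_code (N - card Z) k' d C' \<and> all_one_vec (N - card Z) \<in> C' \<and>
    K \<le> k' + card Z \<and> k' \<le> K"
proof -
  have sub: "vec_subspace N C" and card: "card C = CARD('a) ^ K"
    and wt: "\<And>x. x \<in> C \<Longrightarrow> x \<noteq> 0\<^sub>v N \<Longrightarrow> d \<le> hamming_weight x"
    using code unfolding weight_code_def by auto
  note CN = vec_subspaceD(1)[OF sub]
  have fin: "finite C"
    using finite_carrier_vec CN by (rule rev_finite_subset)
  define S where "S = {i. i < N \<and> c $ i \<noteq> 0}"
  define M where "M = N - card Z"
  have "S = {..<N} - Z" "Z \<subseteq> {..<N}"
    by (auto simp: S_def Z_def)
  then have "card S = M"
    unfolding M_def by (simp add: card_Diff_subset finite_subset)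
  moreover have "finite S" by (simp add: S_def)
  \<comment> \<open>\<open>\<sigma>\<close> renumbers the support of \<open>c\<close> as the
    coordinates of the shortened code.\<close>
  ultimately obtain \<sigma> where "bij_betw \<sigma> {0..<M} S"
    using ex_bij_betw_nat_finite by blast
  then have \<sigma>: "bij_betw \<sigma> {..<M} S"
    by (simp add: lessThan_atLeast0)
  have \<sigma>S: "\<sigma> j < N" "c $ \<sigma> j \<noteq> 0" if "j < M" for j
    using bij_betwE[OF \<sigma>] that by (auto simp: S_def)
  have \<sigma>_ex: "\<exists>j<M. \<sigma> j = i" if "i < N" "c $ i \<noteq> 0" for i
  proof -
    have "i \<in> \<sigma> ` {..<M}"
      unfolding bij_betw_imp_surj_on[OF \<sigma>] using that by (simp add: S_def)
    then show ?thesis by blast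
  qed
  define C0 where "C0 = {x \<in> C. \<forall>i\<in>Z. x $ i = 0}"
  define T where "T x = vec M (\<lambda>j. x $ \<sigma> j / c $ \<sigma> j)" for x
  have T_eq: "T x $ j = x $ \<sigma> j / c $ \<sigma> j" if "j < M" for x j
    using that by (simp add: T_def)
  have C0: "x \<in> C" "x \<in> carrier_vec N" "\<And>i. i < N \<Longrightarrow> c $ i = 0 \<Longrightarrow> x $ i = 0" if "x \<in> C0" for x
    using that CN by (auto simp: C0_def Z_def)
  have inj: "inj_on T C0"
  proof (rule inj_onI)
    fix x y assume xy: "x \<in> C0" "y \<in> C0" and eq: "T x = T y"
    have "x $ i = y $ i" if i: "i < N" for i
    proof (cases "c $ i = 0")
      case True
      then show ?thesis using C0(3) xy i by simp
    next
      case False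
      then obtain j where j: "j < M" "\<sigma> j = i" using \<sigma>_ex i by blast
      then show ?thesis using T_eq[OF j(1), of x] T_eq[OF j(1), of y] eq False by simp
    qed
    then show "x = y" using C0(2) xy by (metis carrier_vecD eq_vecI)
  qed
  define C' where "C' = T ` C0"
  have T_in: "T x \<in> C'" if "x \<in> C0" for x
    using that unfolding C'_def by blast
  have sub': "vec_subspace M C'"
    unfolding vec_subspace_iff
  proof (intro conjI ballI allI)
    show "C' \<subseteq> carrier_vec M"
      by (auto simp: C'_def T_def)
    have "0\<^sub>v N \<in> C0"
      using vec_subspaceD(2)[OF sub] by (auto simp: C0_def Z_def)
    moreover have "0\<^sub>v M = T (0\<^sub>v N)"
      using \<sigma>S by (intro eq_vecI) (auto simp: T_def)
    ultimately show "0\<^sub>v M \<in> C'"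
      using T_in by simp
  next
    fix x y assume "x \<in> C'" "y \<in> C'"
    then obtain x0 y0 where 0: "x0 \<in> C0" "y0 \<in> C0" and xy: "x = T x0" "y = T y0"
      by (auto simp: C'_def)
    have "x + y = T (x0 + y0)"
      unfolding xy using C0(2)[OF 0(1)] C0(2)[OF 0(2)] \<sigma>S
      by (intro eq_vecI) (auto simp: T_def add_divide_distrib)
    moreover have "x0 + y0 \<in> C0"
      using 0 C0(2)[OF 0(1)] C0(2)[OF 0(2)] vec_subspaceD(3)[OF sub] by (auto simp: C0_def Z_def)
    ultimately show "x + y \<in> C'"
      using T_in by simp
  next
    fix b x assume "x \<in> C'"
    then obtain x0 where 0: "x0 \<in> C0" and x: "x = T x0"
      by (auto simp: C'_def)
    have "b \<cdot>\<^sub>v x = T (b \<cdot>\<^sub>v x0)"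
      unfolding x using C0(2)[OF 0] \<sigma>S by (intro eq_vecI) (auto simp: T_def)
    moreover have "b \<cdot>\<^sub>v x0 \<in> C0"
      using 0 C0(2)[OF 0] vec_subspaceD(4)[OF sub] by (auto simp: C0_def Z_def)
    ultimately show "b \<cdot>\<^sub>v x \<in> C'"
      using T_in by simp
  qed
  then obtain k' where card': "card C' = CARD('a) ^ k'"
    using card_vec_subspace by blast
  have card_C0: "card C0 = card C'"
    unfolding C'_def using card_image[OF inj] by simp
  have "d \<le> hamming_weight x" if "x \<in> C'" "x \<noteq> 0\<^sub>v M" for x
  proof -
    from that(1) obtain x0 where 0: "x0 \<in> C0" and x: "x = T x0"
      by (auto simp: C'_def)
    have "x0 \<noteq> 0\<^sub>v N"
    proof
      assume "x0 = 0\<^sub>v N"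
      then have "x = 0\<^sub>v M"
        unfolding x using \<sigma>S by (intro eq_vecI) (auto simp: T_def)
      then show False using that(2) by simp
    qed
    then have "d \<le> hamming_weight x0"
      using wt C0(1)[OF 0] by blast
    \<comment> \<open>The support of \<open>x0\<close> lies inside that of \<open>c\<close>, so
      \<open>\<sigma>\<close> carries the new support onto the old one.\<close>
    also have "{i. i < N \<and> x0 $ i \<noteq> 0} = \<sigma> ` {j. j < M \<and> x $ j \<noteq> 0}"
    proof (intro subset_antisym subsetI)
      fix i assume i: "i \<in> {i. i < N \<and> x0 $ i \<noteq> 0}"
      then have "c $ i \<noteq> 0" using C0(3)[OF 0] by blast
      then show "i \<in> \<sigma> ` {j. j < M \<and> x $ j \<noteq> 0}"
        using i \<sigma>_ex[of i] by (auto simp: x T_eq)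
    qed (auto simp: x T_eq \<sigma>S)
    then have "hamming_weight x0 = card (\<sigma> ` {j. j < M \<and> x $ j \<noteq> 0})"
      using C0(2)[OF 0] by (simp add: hamming_weight_def)
    also have "\<dots> = card {j. j < M \<and> x $ j \<noteq> 0}"
      using \<sigma> by (intro card_image) (auto simp: bij_betw_def inj_on_def)
    also have "\<dots> = hamming_weight x"
      by (simp add: hamming_weight_def x T_def)
    finally show ?thesis .
  qed
  with sub' card' have "weight_code M k' d C'"
    unfolding weight_code_def by blast
  moreover have "all_one_vec M = T c"
    using \<sigma>S by (intro eq_vecI) (auto simp: all_one_vec_def T_def)
  then have "all_one_vec M \<in> C'"
    using T_in[of c] c by (auto simp: C0_def Z_def)
  \<comment> \<open>Both bounds on \<open>k'\<close> come from comparing exponents of powers of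
    \<open>q\<close>.\<close>
  moreover have "CARD('a) ^ K \<le> CARD('a) ^ (k' + card Z)"
    using card_vec_subspace_le_shortened[OF sub \<open>Z \<subseteq> {..<N}\<close>] card card' card_C0
    by (simp add: C0_def power_add mult.commute)
  then have "K \<le> k' + card Z"
    using one_less_CARD_field[where 'a = 'a] power_le_imp_le_exp by blast
  moreover have "card C0 \<le> card C"
    by (intro card_mono fin) (auto simp: C0_def)
  then have "k' \<le> K"
    using one_less_CARD_field[where 'a = 'a] power_le_imp_le_exp card card' card_C0 by metis
  ultimately show ?thesis
    unfolding M_def by blast
qed

section \<open>Masking\<close>

lemma hamming_weight_triangle:
  fixes e e' :: "'a::field vec"
  assumes "e \<in> carrier_vec N" "e' \<in> carrier_vec N"
  shows "hamming_weight (e - e') \<le> hamming_weight e + hamming_weight e'"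
proof -
  have "hamming_weight (e - e') \<le> card ({i. i < N \<and> e $ i \<noteq> 0} \<union> {i. i < N \<and> e' $ i \<noteq> 0})"
    unfolding hamming_weight_def using assms by (intro card_mono) auto
  also have "\<dots> \<le> hamming_weight e + hamming_weight e'"
    using card_Un_le[of "{i. i < N \<and> e $ i \<noteq> 0}" "{i. i < N \<and> e' $ i \<noteq> 0}"] assms
    by (simp add: hamming_weight_def)
  finally show ?thesis .
qed

lemma all_one_vec_carrier [simp]: "all_one_vec N \<in> carrier_vec N"
  by (simp add: all_one_vec_def)

lemma dim_all_one_vec [simp]: "dim_vec (all_one_vec N) = N"
  by (simp add: all_one_vec_def)

lemma index_all_one_vec [simp]: "i < N \<Longrightarrow> all_one_vec N $ i = 1"
  by (simp add: all_one_vec_def)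

text \<open>At level 1 masking means making the stuck entries nonzero. A shift by a multiple of the
  all-one vector does this and stays inside \<open>C\<close>, so error correction is
  unaffected.\<close>

lemma psmc_of_weight_code:
  fixes C :: "'a::{field,finite} vec set" and r :: "'a rel"
  assumes code: "weight_code N K d C" and one: "all_one_vec N \<in> C"
    and "0 < N" "0 < d" and r: "\<And>a. a \<noteq> 0 \<Longrightarrow> (1, a) \<in> r" and u: "u < CARD('a)"
  shows "\<exists>enc dec. psmc r 1 u ((d - 1) div 2) N (carrier_vec (K - 1) :: 'a vec set) enc dec"
proof -
  let ?t = "(d - 1) div 2"
  let ?M = "carrier_vec (K - 1) :: 'a vec set"
  let ?one = "all_one_vec N :: 'a vec"
  have sub: "vec_subspace N C" and card: "card C = CARD('a) ^ K"
    and wt: "\<And>x. x \<in> C \<Longrightarrow> x \<noteq> 0\<^sub>v N \<Longrightarrow> d \<le> hamming_weight x"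
    using code unfolding weight_code_def by auto
  note CN = vec_subspaceD(1)[OF sub]
  \<comment> \<open>Representatives of \<open>C\<close> modulo multiples of the all-one vector:
    entry 0 of a codeword reveals its shift, and subtracting that shift lands in
    \<open>C0\<close>.\<close>
  define C0 where "C0 = {x \<in> C. x $ 0 = 0}"
  have C0: "x \<in> C" "x \<in> carrier_vec N" "x $ 0 = 0" if "x \<in> C0" for x
    using that CN by (auto simp: C0_def)
  have word_inj: "x = y \<and> a = b"
    if "x \<in> C0" "y \<in> C0" "x + a \<cdot>\<^sub>v ?one = y + b \<cdot>\<^sub>v ?one" for x y a b
  proof -
    have carr: "x \<in> carrier_vec N" "y \<in> carrier_vec N"
      using that C0 by auto
    have eq: "x $ i + a = y $ i + b" if "i < N" for i
      using arg_cong[OF \<open>x + _ = _\<close>, of "\<lambda>z. z $ i"] that carr by simp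
    from eq[of 0] have "a = b"
      using \<open>0 < N\<close> that C0(3) by simp
    with eq show ?thesis using carr by auto
  qed
  have "bij_betw (\<lambda>(x, a). x + a \<cdot>\<^sub>v ?one) (C0 \<times> UNIV) C"
    unfolding bij_betw_def
  proof
    show "inj_on (\<lambda>(x, a). x + a \<cdot>\<^sub>v ?one) (C0 \<times> UNIV)"
      using word_inj by (auto intro!: inj_onI)
    have "x + a \<cdot>\<^sub>v ?one \<in> C" if "x \<in> C0" for x a
      using that C0(1) one vec_subspaceD(3,4)[OF sub] by blast
    moreover have "x \<in> (\<lambda>(x, a). x + a \<cdot>\<^sub>v ?one) ` (C0 \<times> UNIV)" if x: "x \<in> C" for x
    proof -
      have "x \<in> carrier_vec N" using x CN by blast
      then have "x = (x - x $ 0 \<cdot>\<^sub>v ?one) + x $ 0 \<cdot>\<^sub>v ?one" "(x - x $ 0 \<cdot>\<^sub>v ?one) $ 0 = 0"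
        using \<open>0 < N\<close> by auto
      moreover have "x - x $ 0 \<cdot>\<^sub>v ?one \<in> C"
        using x one vec_subspaceD(4,5)[OF sub] by blast
      ultimately show ?thesis
        by (intro image_eqI[of _ _ "(x - x $ 0 \<cdot>\<^sub>v ?one, x $ 0)"]) (auto simp: C0_def)
    qed
    ultimately show "(\<lambda>(x, a). x + a \<cdot>\<^sub>v ?one) ` (C0 \<times> UNIV) = C"
      by auto
  qed
  then have "card C0 * CARD('a) = CARD('a) ^ K"
    using bij_betw_same_card card by (fastforce simp: card_cartesian_product)
  \<comment> \<open>\<open>K = 0\<close> would give \<open>card C0 * q = 1\<close>, impossible for
    \<open>q > 1\<close>; so \<open>K - 1\<close> does not truncate.\<close>
  then have card_C0: "card C0 = CARD('a) ^ (K - 1)"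
    using one_less_CARD_field[where 'a = 'a] by (cases K) auto
  \<comment> \<open>By equal cardinality any bijection from the messages to the representatives can
    serve as \<open>g\<close>.\<close>
  have "finite C0"
    using finite_carrier_vec by (rule rev_finite_subset) (use C0(2) in blast)
  then obtain g where g: "bij_betw g ?M C0"
    using finite_same_card_bij[OF finite_carrier_vec] card_C0 card_carrier_vec by metis
  have gC: "g m \<in> C0" if "m \<in> ?M" for m
    using g that bij_betwE by blast
  \<comment> \<open>Each stuck cell excludes exactly one shift \<open>a\<close>, so \<open>u < q\<close> of them leave at least one.\<close>
  have "\<exists>a. \<forall>i\<in>P. x $ i + a \<noteq> 0" if P: "P \<subseteq> {..<N}" "card P = u" for P and x :: "'a vec"
  proof -
    have "finite P" using P finite_subset by blast
    then have "card ((\<lambda>i. - x $ i) ` P) < CARD('a)"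
      using card_image_le[of P "\<lambda>i. - x $ i"] P u by linarith
    then have "(\<lambda>i. - x $ i) ` P \<noteq> UNIV" by auto
    then obtain a where "a \<notin> (\<lambda>i. - x $ i) ` P" by blast
    then have "\<forall>i\<in>P. x $ i + a \<noteq> 0"
      by (auto simp: image_iff eq_neg_iff_add_eq_0 add.commute)
    then show ?thesis by blast
  qed
  then obtain sh where sh: "\<And>P x i. P \<subseteq> {..<N} \<Longrightarrow> card P = u \<Longrightarrow> i \<in> P \<Longrightarrow> x $ i + sh P x \<noteq> (0::'a)"
    by metis
  define enc where "enc P m = g m + sh P (g m) \<cdot>\<^sub>v ?one" for P m
  \<comment> \<open>The shift \<open>a\<close> is existentially quantified, so decoding never refers
    to the stuck set \<open>P\<close>.\<close>
  define ok where "ok y m \<longleftrightarrow> m \<in> ?M \<and>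
    (\<exists>a. \<exists>e\<in>carrier_vec N. hamming_weight e \<le> ?t \<and> y = g m + a \<cdot>\<^sub>v ?one + e)" for y m
  have ok_unique: "m = m'" if "ok y m" "ok y m'" for y m m'
  proof -
    from that obtain a e a' e' where m: "m \<in> ?M" "m' \<in> ?M"
      and e: "e \<in> carrier_vec N" "e' \<in> carrier_vec N" "hamming_weight e \<le> ?t" "hamming_weight e' \<le> ?t"
      and y: "y = g m + a \<cdot>\<^sub>v ?one + e" "y = g m' + a' \<cdot>\<^sub>v ?one + e'"
      unfolding ok_def by blast
    let ?w = "g m + a \<cdot>\<^sub>v ?one" and ?w' = "g m' + a' \<cdot>\<^sub>v ?one"
    have w: "?w \<in> C" "?w' \<in> C"
      using gC m C0(1) one vec_subspaceD(3,4)[OF sub] by blast+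
    then have wN: "?w \<in> carrier_vec N" "?w' \<in> carrier_vec N"
      using CN by blast+
    have sub_eq: "p - p' = b' - b" if "p + b = p' + b'" for p p' b b' :: 'a
      using that by (simp add: algebra_simps)
    have diff: "?w - ?w' = e' - e"
    proof (rule eq_vecI)
      fix i assume "i < dim_vec (e' - e)"
      then have i: "i < N" using e by simp
      have "(?w + e) $ i = (?w' + e') $ i"
        using y by metis
      then have "?w $ i + e $ i = ?w' $ i + e' $ i"
        using i e(1,2) by (simp only: index_add_vec(1) carrier_vecD)
      then have "?w $ i - ?w' $ i = e' $ i - e $ i"
        by (rule sub_eq)
      then show "(?w - ?w') $ i = (e' - e) $ i"
        using i e(1,2) wN by (metis carrier_vecD index_minus_vec(1))
    qed (use e wN in auto)
    \<comment> \<open>Two explanations of the same received word differ by a codeword of weight at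
      most \<open>2 * ?t < d\<close>, which must be zero.\<close>
    have "hamming_weight (?w - ?w') \<le> ?t + ?t"
      unfolding diff using hamming_weight_triangle[OF e(2,1)] e(3,4) by linarith
    also have "\<dots> < d"
      using \<open>0 < d\<close> by presburger
    finally have zero: "?w - ?w' = 0\<^sub>v N"
      using wt[of "?w - ?w'"] vec_subspaceD(5)[OF sub w] by (meson not_le)
    have "?w = ?w'"
    proof (rule eq_vecI)
      fix i assume "i < dim_vec ?w'"
      then have i: "i < N" using wN(2) by (metis carrier_vecD)
      have "(?w - ?w') $ i = 0" using zero i by simp
      then show "?w $ i = ?w' $ i"
        using i wN by (metis carrier_vecD index_minus_vec(1) right_minus_eq)
    qed (use wN in \<open>metis carrier_vecD\<close>)
    then have "g m = g m'"
      using word_inj gC m by blast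
    then show "m = m'"
      using g m by (meson bij_betw_def inj_onD)
  qed
  have enc: "enc P m \<in> carrier_vec N" "\<forall>i\<in>P. (1, enc P m $ i) \<in> r"
    if P: "P \<subseteq> {..<N}" "card P = u" and m: "m \<in> ?M" for P m
  proof -
    have gm: "g m \<in> carrier_vec N"
      using gC C0(2) m by blast
    then show "enc P m \<in> carrier_vec N"
      by (simp add: enc_def)
    show "\<forall>i\<in>P. (1, enc P m $ i) \<in> r"
    proof
      fix i assume i: "i \<in> P"
      have "enc P m $ i = g m $ i + sh P (g m)"
        using i P gm by (auto simp: enc_def)
      then show "(1, enc P m $ i) \<in> r"
        using r sh[OF P i, of "g m"] by simp
    qed
  qed
  \<comment> \<open>Uniqueness makes \<open>THE\<close> correct on every word within distance
    \<open>?t\<close> of an encoder output; elsewhere its value is irrelevant.\<close>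
  define dec where "dec y = (THE m. ok y m)" for y
  have dec: "dec (enc P m + e) = m"
    if "m \<in> ?M" "e \<in> carrier_vec N" "hamming_weight e \<le> ?t" for P m e
  proof -
    have "ok (enc P m + e) m"
      unfolding ok_def enc_def using that by blast
    then show ?thesis
      unfolding dec_def using ok_unique by (intro the_equality)
  qed
  have "psmc r 1 u ?t N ?M enc dec"
    unfolding psmc_def
  proof (intro allI impI)
    fix P m assume "P \<subseteq> {..<N} \<and> card P = u \<and> m \<in> ?M"
    then show "enc P m \<in> carrier_vec N \<and> (\<forall>i\<in>P. (1, enc P m $ i) \<in> r) \<and>
        (\<forall>e\<in>carrier_vec N. hamming_weight e \<le> ?t \<longrightarrow> dec (enc P m + e) = m)"
      using enc[of P m] dec[of m _ P] by simp
  qed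
  then show ?thesis by blast
qed

theorem corollary1:
  fixes q u n k d :: nat
    and r :: "'a::{field,finite} rel"
  assumes "prime q"
    and "CARD('a) = q"
    and "cell_order r"
    and "u < q"
    and "0 < n" and "0 < k" and "0 < d"
    and "k \<le> n" and "d \<le> n"
    and "(\<Sum>i<d - 1. ((n - 1) choose i) * (q - 1) ^ i) < q ^ (n - k)"
  shows "\<exists>n' k'.
      int n - int d + 2 \<le> int n' \<and> n' \<le> n + 1 \<and>
      int k - int d + 2 \<le> int k' \<and> k' \<le> k + 1 \<and>
      (\<exists>C :: 'a vec set. linear_code n' k' d C \<and> all_one_vec n' \<in> C) \<and>
      (\<exists>enc dec. psmc r 1 u ((d - 1) div 2) n'
         (carrier_vec (k' - 1) :: 'a vec set) enc dec)"
proof -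
  obtain C :: "'a vec set" where C: "weight_code n k d C"
    using gilbert_varshamov[where 'a = 'a] assms(2,8,10) by blast
  then have CN: "C \<subseteq> carrier_vec n"
    using vec_subspaceD(1) unfolding weight_code_def by blast
  have "\<exists>n' k' C'. weight_code n' k' d (C' :: 'a vec set) \<and> all_one_vec n' \<in> C' \<and> 0 < n' \<and>
      int n - int d + 2 \<le> int n' \<and> n' \<le> n + 1 \<and> int k - int d + 2 \<le> int k' \<and> k' \<le> k + 1"
  proof (cases "\<forall>c\<in>C. d - 1 \<le> hamming_weight (all_one_vec n - c)")
    case True
    have "vec (Suc n) (\<lambda>i. if i < n then all_one_vec n $ i else 1 :: 'a) = all_one_vec (Suc n)"
      by (intro eq_vecI) (auto simp: all_one_vec_def)
    then obtain C' :: "'a vec set"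
      where "weight_code (Suc n) (Suc k) d C'" "all_one_vec (Suc n) \<in> C'"
      using weight_code_extend[OF C all_one_vec_carrier] True by metis
    then show ?thesis
      using \<open>0 < d\<close> by - (rule exI[of _ "Suc n"], rule exI[of _ "Suc k"], rule exI[of _ C'], auto)
  next
    case False
    then obtain c where c: "c \<in> C" "hamming_weight (all_one_vec n - c) < d - 1"
      by (auto simp: not_le)
    define Z where "Z = {i. i < n \<and> c $ i = 0}"
    have cn: "c \<in> carrier_vec n"
      using c CN by blast
    \<comment> \<open>Where \<open>c\<close> vanishes, the all-one vector minus \<open>c\<close> has
      entry 1.\<close>
    have "card Z \<le> hamming_weight (all_one_vec n - c)"
      unfolding hamming_weight_def using cn by (intro card_mono) (auto simp: Z_def)
    \<comment> \<open>A number below the truncated \<open>d - 1\<close> forces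
      \<open>d \<ge> 2\<close>, so at most \<open>d - 2\<close> coordinates are lost.\<close>
    with c(2) have Z: "card Z + 2 \<le> d" by linarith
    from weight_code_shorten[OF C c(1)] obtain C' :: "'a vec set" and k' where
      "weight_code (n - card Z) k' d C'" "all_one_vec (n - card Z) \<in> C'" "k \<le> k' + card Z" "k' \<le> k"
      unfolding Z_def by blast
    \<comment> \<open>With \<open>d \<le> n\<close> the remaining length is at least 2, and
      \<open>k \<le> k' + card Z\<close> gives the lower bound on \<open>k'\<close>.\<close>
    with Z \<open>d \<le> n\<close> show ?thesis
      by - (rule exI[of _ "n - card Z"], rule exI[of _ k'], rule exI[of _ C'], auto)
  qed
  then obtain n' k' and C' :: "'a vec set"
    where C': "weight_code n' k' d C'" "all_one_vec n' \<in> C'" "0 < n'"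
      and bounds: "int n - int d + 2 \<le> int n'" "n' \<le> n + 1" "int k - int d + 2 \<le> int k'" "k' \<le> k + 1"
    by blast
  have "\<exists>enc dec. psmc r 1 u ((d - 1) div 2) n' (carrier_vec (k' - 1) :: 'a vec set) enc dec"
    using assms(2,3,4,7) by (intro psmc_of_weight_code[OF C']) (auto simp: cell_order_def)
  then show ?thesis
    using bounds weight_code_imp_linear_code[OF C'(1)] C'(2) by blast
qed

end
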